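(* Let $\boldsymbol{A}\in\mathbb{R}^{d\times d}$ be symmetric positive definite, let $\boldsymbol{G}_0$ be a random symmetric matrix such that $\boldsymbol{G}_0\succeq\boldsymbol{A}$ always holds, and let $\boldsymbol{G}_{k+1}=\mathrm{SR1}(\boldsymbol{G}_k,\boldsymbol{A},\boldsymbol{u}_k)$ for $k\ge 0$, where the directions are chosen either by (greedy method) $\boldsymbol{u}_k\in\arg\max_{\boldsymbol{u}\in\{\boldsymbol{e}_1,\dots,\boldsymbol{e}_d\}}\boldsymbol{u}^\top(\boldsymbol{G}_k-\boldsymbol{A})\boldsymbol{u}$, or (random method) $\boldsymbol{u}_k\sim\mathcal{N}(\boldsymbol{0},\boldsymbol{I}_d)$ for all $k$, or $\boldsymbol{u}_k\sim\mathrm{Unif}(\mathcal{S}^{d-1})$ for all $k$, drawn independently of $\boldsymbol{G}_0,\boldsymbol{u}_0,\dots,\boldsymbol{u}_{k-1}$. Let $\tau_k=\mathrm{tr}(\boldsymbol{G}_k-\boldsymbol{A})$, and assume $\mathbb{E}\tau_0<\infty$. Then, for either method, $$\forall k\ge 0:\quad \boldsymbol{G}_k\succeq\boldsymbol{A}\quad\text{and}\quad 0\le\mathbb{E}\,\tau_k\le\left(1-\frac{k}{d}\right)_+\mathbb{E}\,\tau_0 .$$ Hence $\mathbb{E}\,\tau_k$ converges to zero superlinearly. In particular, for all $k\ge d$, $\boldsymbol{G}_k=\boldsymbol{A}$ for the greedy method, and $\boldsymbol{G}_k=\boldsymbol{A}$ almost surely for the random method.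
   Context: $\preceq$ is the Loewner order; $(x)_+=\max\{x,0\}$; $\boldsymbol{e}_1,\dots,\boldsymbol{e}_d$ are the standard basis vectors; $\mathrm{Unif}(\mathcal{S}^{d-1})$ is the uniform distribution on the unit sphere of $\mathbb{R}^d$. SR1 update: for symmetric $\boldsymbol{G}\succeq\boldsymbol{A}\succ0$ and $\boldsymbol{u}\in\mathbb{R}^d$, $\mathrm{SR1}(\boldsymbol{G},\boldsymbol{A},\boldsymbol{u})=\boldsymbol{G}$ if $\boldsymbol{G}\boldsymbol{u}=\boldsymbol{A}\boldsymbol{u}$, and otherwise $\mathrm{SR1}(\boldsymbol{G},\boldsymbol{A},\boldsymbol{u})=\boldsymbol{G}-\frac{(\boldsymbol{G}-\boldsymbol{A})\boldsymbol{u}\boldsymbol{u}^\top(\boldsymbol{G}-\boldsymbol{A})}{\boldsymbol{u}^\top(\boldsymbol{G}-\boldsymbol{A})\boldsymbol{u}}$. Ties in the arg max are broken arbitrarily. The expectation is over $\boldsymbol{G}_0$ and all the directions (for the greedy method there is no randomness in the directions). A sequence $\{y_k\}$ converges to $y^*$ superlinearly (in the R-sense) if there is a scalar sequence $x_k\to 0$ with $\lim_{k\to\infty}|x_{k+1}|/|x_k|=0$ and $|y_k-y^*|\le|x_k|$ for all $k\ge 0$. *)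

theory Defs
  imports "HOL-Probability.Probability"
begin

definition pos_semidef :: "real^'n^'n \<Rightarrow> bool" where
  "pos_semidef B \<longleftrightarrow> transpose B = B \<and> (\<forall>x. 0 \<le> x \<bullet> (B *v x))"

definition pos_def :: "real^'n^'n \<Rightarrow> bool" where
  "pos_def B \<longleftrightarrow> transpose B = B \<and> (\<forall>x. x \<noteq> 0 \<longrightarrow> 0 < x \<bullet> (B *v x))"

definition loewner_le :: "real^'n^'n \<Rightarrow> real^'n^'n \<Rightarrow> bool"  (infix \<open>\<preceq>\<^sub>L\<close> 50) where
  "A \<preceq>\<^sub>L B \<longleftrightarrow> pos_semidef (B - A)"

definition outer :: "real^'n \<Rightarrow> real^'n \<Rightarrow> real^'n^'n" where
  "outer u v = (\<chi> i j. u $ i * v $ j)"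

definition SR1 :: "real^'n^'n \<Rightarrow> real^'n^'n \<Rightarrow> real^'n \<Rightarrow> real^'n^'n" where
  "SR1 G A u =
     (if G *v u = A *v u then G
      else G - (1 / (u \<bullet> ((G - A) *v u))) *\<^sub>R ((G - A) ** outer u u ** (G - A)))"

text \<open>The greedy direction is any maximiser of the quadratic form over the standard basis; which
  one is taken in case of a tie may depend on the sample point and on the step.\<close>

definition greedy_directions ::
    "'w measure \<Rightarrow> real^'n^'n \<Rightarrow> (nat \<Rightarrow> 'w \<Rightarrow> real^'n^'n) \<Rightarrow> (nat \<Rightarrow> 'w \<Rightarrow> real^'n) \<Rightarrow> bool" where
  "greedy_directions M A G u \<longleftrightarrow>
     (\<forall>k. \<forall>\<omega>\<in>space M.
        is_arg_max (\<lambda>v. v \<bullet> ((G k \<omega> - A) *v v)) (\<lambda>v. v \<in> range (\<lambda>i. axis i 1)) (u k \<omega>))"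

definition std_normal_vec :: "(real^'n) measure" where
  "std_normal_vec = density lborel (\<lambda>x. ennreal (\<Prod>i\<in>UNIV. std_normal_density (x $ i)))"

text \<open>The uniform distribution on the unit sphere is the normalised surface measure, obtained as the
  law of the radial projection of a uniform point of the unit ball. The centre of the ball, where
  the projection takes the junk value 0, is a null set.\<close>

definition unif_sphere :: "(real^'n) measure" where
  "unif_sphere = distr (uniform_measure lborel (ball 0 1)) borel (\<lambda>x. x /\<^sub>R norm x)"

lemma prob_space_unif_ball: "prob_space (uniform_measure lborel (ball (0 :: real^'n) 1))"
proof (rule prob_space_uniform_measure)
  have "measure lborel (ball (0 :: real^'n) 1) > 0"
    by (intro content_ball_pos) simp
  then show "emeasure lborel (ball (0 :: real^'n) 1) \<noteq> 0"
    by (auto simp: measure_def)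
  show "emeasure lborel (ball (0 :: real^'n) 1) \<noteq> \<infinity>"
    using emeasure_bounded_finite[OF bounded_ball, of "0 :: real^'n" 1] by auto
qed

lemma prob_space_unif_sphere: "prob_space (unif_sphere :: (real^'n) measure)"
  unfolding unif_sphere_def
  by (intro prob_space.prob_space_distr prob_space_unif_ball) (simp add: uniform_measure_def)

lemma AE_unif_sphere: "AE x in (unif_sphere :: (real^'n) measure). x \<in> sphere 0 1"
proof -
  have "AE x in lborel. x \<noteq> (0 :: real^'n)"
    by (rule AE_lborel_singleton)
  then have "AE x in uniform_measure lborel (ball (0 :: real^'n) 1). x \<noteq> 0"
    by (intro AE_uniform_measureI) auto
  then have "AE x in uniform_measure lborel (ball (0 :: real^'n) 1). x /\<^sub>R norm x \<in> sphere 0 1"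
    by eventually_elim simp
  then show ?thesis
    unfolding unif_sphere_def
    by (subst AE_distr_iff) (auto simp: uniform_measure_def)
qed

text \<open>Every direction is drawn from the same law, either normal or uniform on the sphere, and is
  independent of the whole tuple formed by the initial matrix and all earlier directions. This is
  stated for the generated sigma-algebras, as \<open>indep_var\<close> needs both variables to have the same type.\<close>

definition random_directions ::
    "'w measure \<Rightarrow> ('w \<Rightarrow> real^'n^'n) \<Rightarrow> (nat \<Rightarrow> 'w \<Rightarrow> real^'n) \<Rightarrow> bool" where
  "random_directions M G0 u \<longleftrightarrow>
     ((\<forall>k. distr M borel (u k) = std_normal_vec) \<or> (\<forall>k. distr M borel (u k) = unif_sphere)) \<and>
     (\<forall>k. prob_space.indep_set M
            (sets (vimage_algebra (space M) (u k) borel))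
            (sets (vimage_algebra (space M) (\<lambda>\<omega>. (G0 \<omega>, \<lambda>i\<in>{..<k}. u i \<omega>))
               (borel \<Otimes>\<^sub>M PiM {..<k} (\<lambda>_. borel)))))"

text \<open>The quotients only make sense for a comparison sequence without zeros. This has to be required
  explicitly, as otherwise division by zero would make zeros of \<open>x\<close> harmless and the notion void.\<close>

definition superlinearly_converges :: "(nat \<Rightarrow> real) \<Rightarrow> real \<Rightarrow> bool" where
  "superlinearly_converges y l \<longleftrightarrow>
     (\<exists>x :: nat \<Rightarrow> real. (\<forall>k. x k \<noteq> 0) \<and> x \<longlonglongrightarrow> 0 \<and>
        (\<lambda>k. \<bar>x (Suc k)\<bar> / \<bar>x k\<bar>) \<longlonglongrightarrow> 0 \<and> (\<forall>k. \<bar>y k - l\<bar> \<le> \<bar>x k\<bar>))"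

end

theory Submission
  imports Defs
begin

text \<open>
  Put \<open>R\<^sub>k = G\<^sub>k - A\<close>, which is positive semidefinite. A step with \<open>R u \<noteq> 0\<close> lowers the trace by
  \<open>|R u|\<^sup>2 / (u \<bullet> R u)\<close> and puts \<open>u\<close> into the kernel, so it lowers the rank. After \<open>k\<close> steps at most
  \<open>r = d - k\<close> columns of \<open>R\<^sub>k\<close> are nonzero (greedy), or the rank is at most \<open>r\<close> almost surely (random).
  It remains to see that the trace drops by at least \<open>tr R / r\<close> (in the random case, on average
  over \<open>u\<close>); then \<open>1 - 1/d, 1 - 1/(d - 1), \<dots>\<close> multiply up to \<open>1 - k/d\<close>.

  For the greedy method the drop is at least the largest diagonal entry. For the random method let
  \<open>P\<close> be the orthogonal projection onto the range of \<open>R\<close>. By Cauchy-Schwarz the drop is at least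
  \<open>(u \<bullet> R u) / |P u|\<^sup>2\<close>. In an orthonormal basis of the range, reflections that flip one basis vector
  or swap two of them preserve the law of \<open>u\<close>, so the expectation of \<open>P u (P u)\<^sup>T / |P u|\<^sup>2\<close> is a
  multiple of the identity with trace 1, and the expectation of the bound is \<open>tr R / rank R\<close>.
\<close>

subsection \<open>The SR1 update of a positive semidefinite residual\<close>

lemma inner_matrix_vector_symmetric:
  fixes R :: "real^'n^'n"
  assumes "transpose R = R"
  shows "x \<bullet> (R *v y) = (R *v x) \<bullet> y"
  by (metis assms dot_lmul_matrix vector_transpose_matrix)

text \<open>Follows from nonnegativity of the form at \<open>s *\<^sub>R x - t *\<^sub>R y\<close>
  for suitable \<open>s\<close> and \<open>t\<close>. The form may be degenerate, so
  \<open>y \<bullet> (R *v y) = 0\<close> is a separate case.\<close>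

lemma pos_semidef_Cauchy_Schwarz:
  fixes R :: "real^'n^'n"
  assumes "pos_semidef R"
  shows "(x \<bullet> (R *v y))\<^sup>2 \<le> (x \<bullet> (R *v x)) * (y \<bullet> (R *v y))"
proof -
  have sym: "transpose R = R" and nn: "\<And>x. 0 \<le> x \<bullet> (R *v x)"
    using assms by (auto simp: pos_semidef_def)
  have c: "y \<bullet> (R *v x) = x \<bullet> (R *v y)" for x y
    by (metis sym inner_matrix_vector_symmetric inner_commute)
  define a b e where "a = x \<bullet> (R *v x)" and "b = x \<bullet> (R *v y)" and "e = y \<bullet> (R *v y)"
  have q: "0 \<le> a * s\<^sup>2 - 2 * s * t * b + t\<^sup>2 * e" for s t
    using nn[of "s *\<^sub>R x - t *\<^sub>R y"] c[of y x]
    by (simp add: a_def b_def e_def algebra_simps inner_diff_left inner_diff_right power2_eq_square)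
  have e: "0 \<le> e" and a: "0 \<le> a" by (auto simp: e_def a_def nn)
  have "b\<^sup>2 \<le> a * e"
  proof (cases "e = 0")
    case True
    have "b = 0"
    proof (rule ccontr)
      assume "b \<noteq> 0"
      \<comment> \<open>With \<open>e = 0\<close>, this choice of \<open>t\<close> gives the
        quadratic expression the value -1.\<close>
      with q[of 1 "(a + 1) / (2 * b)"] True show False by (simp add: field_simps)
    qed
    with True show ?thesis by simp
  next
    case False
    have "0 \<le> e * (a * e - b\<^sup>2)"
      using q[of e b] by (simp add: power2_eq_square algebra_simps)
    then show ?thesis using e False by (simp add: zero_le_mult_iff)
  qed
  then show ?thesis by (simp add: a_def b_def e_def)
qed

text \<open>Cauchy-Schwarz for the pair \<open>R *v u\<close>, \<open>u\<close> bounds the fourth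
  power of the norm of \<open>R *v u\<close> by a multiple of
  \<open>u \<bullet> (R *v u)\<close>.\<close>

lemma pos_semidef_quadratic_form_eq_0_iff:
  fixes R :: "real^'n^'n"
  assumes "pos_semidef R"
  shows "u \<bullet> (R *v u) = 0 \<longleftrightarrow> R *v u = 0"
proof
  assume "u \<bullet> (R *v u) = 0"
  then have "((R *v u) \<bullet> (R *v u))\<^sup>2 \<le> 0"
    using pos_semidef_Cauchy_Schwarz[OF assms, of "R *v u" u] by simp
  then show "R *v u = 0" by simp
qed simp

lemma outer_mult_vector: "outer v w *v x = (w \<bullet> x) *\<^sub>R v"
  by (simp add: vec_eq_iff matrix_vector_mult_def outer_def inner_vec_def sum_distrib_left mult_ac)

lemma transpose_outer [simp]: "transpose (outer v v) = outer v v"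
  by (simp add: vec_eq_iff transpose_def outer_def mult.commute)

lemma trace_outer: "trace (outer v w) = v \<bullet> w"
  by (simp add: trace_def outer_def inner_vec_def)

lemma symmetric_mult_outer_mult:
  fixes R :: "real^'n^'n"
  assumes "transpose R = R"
  shows "R ** outer u u ** R = outer (R *v u) (R *v u)"
proof -
  have "(R ** outer u u ** R) *v x = outer (R *v u) (R *v u) *v x" for x
    by (simp add: matrix_vector_mul_assoc[symmetric] outer_mult_vector matrix_vector_mult_scaleR
        inner_matrix_vector_symmetric[OF assms])
  then show ?thesis by (simp add: matrix_eq)
qed

text \<open>The correction involves \<open>G\<close> and \<open>A\<close> only through
  \<open>G - A\<close>, so from here on only residuals with target 0 are studied.\<close>

lemma SR1_diff: "SR1 G A u - A = SR1 (G - A) 0 u"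
  by (simp add: SR1_def matrix_vector_mult_diff_rdistrib)

text \<open>The case distinction disappears because the outer product is zero when
  \<open>R *v u = 0\<close>.\<close>

lemma SR1_0:
  fixes R :: "real^'n^'n"
  assumes "transpose R = R"
  shows "SR1 R 0 u = R - (1 / (u \<bullet> (R *v u))) *\<^sub>R outer (R *v u) (R *v u)"
proof (cases "R *v u = 0")
  case True
  moreover have "outer (0 :: real^'n) 0 = 0" by (simp add: outer_def vec_eq_iff)
  ultimately show ?thesis by (simp add: SR1_def)
qed (simp add: SR1_def symmetric_mult_outer_mult[OF assms])

lemma SR1_0_mult_vector:
  fixes R :: "real^'n^'n"
  assumes "transpose R = R"
  shows "SR1 R 0 u *v x = R *v x - ((x \<bullet> (R *v u)) / (u \<bullet> (R *v u))) *\<^sub>R (R *v u)"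
  by (simp add: SR1_0[OF assms] matrix_vector_mult_diff_rdistrib scaleR_matrix_vector_assoc[symmetric]
      outer_mult_vector inner_commute)

lemma trace_SR1_0:
  fixes R :: "real^'n^'n"
  assumes "transpose R = R"
  shows "trace (SR1 R 0 u) = trace R - ((R *v u) \<bullet> (R *v u)) / (u \<bullet> (R *v u))"
  using trace_outer[of "R *v u" "R *v u"]
  by (simp add: SR1_0[OF assms] trace_def sum_subtractf sum_divide_distrib[symmetric])

text \<open>The quadratic form of the subtracted term at \<open>x\<close> is
  \<open>(x \<bullet> (R *v u))\<^sup>2 / (u \<bullet> (R *v u))\<close>, which Cauchy-Schwarz
  bounds by \<open>x \<bullet> (R *v x)\<close>.\<close>

lemma pos_semidef_SR1_0:
  fixes R :: "real^'n^'n"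
  assumes "pos_semidef R"
  shows "pos_semidef (SR1 R 0 u)"
proof -
  have sym: "transpose R = R" and nn: "\<And>x. 0 \<le> x \<bullet> (R *v x)"
    using assms by (auto simp: pos_semidef_def)
  have "(x \<bullet> (R *v u))\<^sup>2 / (u \<bullet> (R *v u)) \<le> x \<bullet> (R *v x)" for x
    using pos_semidef_Cauchy_Schwarz[OF assms, of x u] nn[of u] nn[of x]
    by (cases "u \<bullet> (R *v u) = 0") (auto simp: divide_simps)
  moreover have "transpose (SR1 R 0 u) = SR1 R 0 u"
    using sym transpose_outer[of "R *v u"]
    by (simp add: SR1_0 vec_eq_iff transpose_def)
  ultimately show ?thesis
    by (simp add: pos_semidef_def SR1_0_mult_vector[OF sym] inner_diff_right power2_eq_square)
qed

lemma SR1_0_mult_eq_0: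
  fixes R :: "real^'n^'n"
  assumes "pos_semidef R"
  shows "SR1 R 0 u *v u = 0"
  using assms pos_semidef_quadratic_form_eq_0_iff[OF assms, of u]
  by (cases "u \<bullet> (R *v u) = 0") (auto simp: pos_semidef_def SR1_0_mult_vector)

lemma SR1_0_mult_eq_0_mono:
  fixes R :: "real^'n^'n"
  assumes "transpose R = R" "R *v x = 0"
  shows "SR1 R 0 u *v x = 0"
  using assms by (simp add: SR1_0_mult_vector inner_matrix_vector_symmetric)

text \<open>The new range lies in the old one and loses \<open>R *v u\<close>: the range of a
  symmetric matrix is orthogonal to its kernel, the new kernel contains \<open>u\<close>, and
  \<open>u \<bullet> (R *v u)\<close> is nonzero.\<close>

lemma dim_range_SR1_0_less:
  fixes R :: "real^'n^'n"
  assumes "pos_semidef R" "R *v u \<noteq> 0"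
  shows "dim (range ((*v) (SR1 R 0 u))) < dim (range ((*v) R))"
proof -
  let ?S = "SR1 R 0 u"
  have sym: "transpose R = R" using assms by (simp add: pos_semidef_def)
  have sym': "transpose ?S = ?S"
    using pos_semidef_SR1_0[OF assms(1)] by (simp add: pos_semidef_def)
  have span: "span (range ((*v) B)) = range ((*v) B)" for B :: "real^'n^'n"
    by (simp add: linear_subspace_image span_eq_iff)
  have "range ((*v) ?S) \<subseteq> range ((*v) R)"
  proof clarify
    fix x
    have "?S *v x = R *v (x - ((x \<bullet> (R *v u)) / (u \<bullet> (R *v u))) *\<^sub>R u)"
      by (simp add: SR1_0_mult_vector[OF sym] matrix_vector_mult_diff_distrib matrix_vector_mult_scaleR)
    then show "?S *v x \<in> range ((*v) R)" by simp
  qed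
  moreover have "R *v u \<notin> range ((*v) ?S)"
  proof
    assume "R *v u \<in> range ((*v) ?S)"
    then obtain x where "R *v u = ?S *v x" by auto
    then have "u \<bullet> (R *v u) = 0"
      using inner_matrix_vector_symmetric[OF sym', of u x] SR1_0_mult_eq_0[OF assms(1), of u] by simp
    then show False using assms pos_semidef_quadratic_form_eq_0_iff by blast
  qed
  ultimately have "span (range ((*v) ?S)) \<subset> span (range ((*v) R))"
    unfolding span by auto
  then show ?thesis by (rule dim_psubset)
qed

lemma pos_semidef_diag_nonneg:
  assumes "pos_semidef R" shows "0 \<le> R $ i $ i"
  using assms unfolding pos_semidef_def
  by (metis inner_axis' matrix_vector_mult_basis column_def vec_lambda_beta mult_1 real_inner_1_left)

lemma pos_semidef_trace_nonneg: "pos_semidef R \<Longrightarrow> 0 \<le> trace R"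
  by (simp add: trace_def sum_nonneg pos_semidef_diag_nonneg)

lemma SR1_0_trace_decrease_nonneg:
  assumes "pos_semidef R"
  shows "0 \<le> ((R *v u) \<bullet> (R *v u)) / (u \<bullet> (R *v u))"
  using assms by (simp add: pos_semidef_def)


lemma trace_SR1_0_le:
  assumes "pos_semidef R"
  shows "trace (SR1 R 0 u) \<le> trace R"
  using SR1_0_trace_decrease_nonneg[OF assms, of u] assms by (simp add: trace_SR1_0 pos_semidef_def)

lemma range_mult_vector_dim_0:
  fixes R :: "real^'n^'n"
  assumes "dim (range ((*v) R)) = 0"
  shows "R = 0"
proof -
  have "R *v x = 0" for x using assms by auto
  then show ?thesis by (simp add: matrix_eq)
qed

section \<open>Zero columns under a greedy step\<close>

lemma axis_quadratic_form: "axis i 1 \<bullet> (R *v axis i 1) = (R :: real^'n^'n) $ i $ i"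
  by (simp add: matrix_vector_mult_basis column_def inner_axis')

text \<open>Phrased through \<open>R *v axis i 1\<close> because a zero column is a basis vector in
  the kernel, and the kernel only grows along the updates. This count takes the place of the rank in
  the greedy method.\<close>

definition nonzero_columns :: "real^'n^'n \<Rightarrow> 'n set" where
  "nonzero_columns R = {i. R *v axis i 1 \<noteq> 0}"

text \<open>Let \<open>u = axis j 1\<close>. If \<open>R \<noteq> 0\<close>, the maximal diagonal
  entry is positive, so column \<open>j\<close> is nonzero; the step annihilates it and revives no
  other column. For the trace, at most \<open>r\<close> diagonal entries are nonzero and each is at
  most \<open>R $ j $ j\<close>, while the drop is at least \<open>R $ j $ j\<close>, an entry of
  \<open>R *v u\<close>.\<close>

lemma greedy_step:
  fixes R :: "real^'n^'n"
  assumes R: "pos_semidef R"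
    and u: "is_arg_max (\<lambda>v. v \<bullet> (R *v v)) (\<lambda>v. v \<in> range (\<lambda>i. axis i 1)) u"
  shows "R \<noteq> 0 \<Longrightarrow> card (nonzero_columns (SR1 R 0 u)) < card (nonzero_columns R)"
    and "card (nonzero_columns R) \<le> r \<Longrightarrow> trace (SR1 R 0 u) \<le> (1 - 1 / real r) * trace R"
proof -
  have sym: "transpose R = R" using R by (simp add: pos_semidef_def)
  obtain j where j: "u = axis j 1" and max: "\<And>i. R $ i $ i \<le> R $ j $ j"
  proof -
    from u obtain j where "u = axis j 1" by (auto simp: is_arg_max_linorder)
    moreover have "R $ i $ i \<le> u \<bullet> (R *v u)" for i
      using u axis_quadratic_form[of i R] unfolding is_arg_max_linorder by (metis rangeI)
    ultimately show thesis using that by (simp add: axis_quadratic_form)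
  qed
  have diag0: "R $ i $ i = 0 \<longleftrightarrow> i \<notin> nonzero_columns R" for i
    using pos_semidef_quadratic_form_eq_0_iff[OF R, of "axis i 1"] axis_quadratic_form[of i R]
    by (simp add: nonzero_columns_def)
  have jj: "0 \<le> R $ j $ j" by (rule pos_semidef_diag_nonneg[OF R])
  show "card (nonzero_columns (SR1 R 0 u)) < card (nonzero_columns R)" if "R \<noteq> 0"
  proof -
    have "j \<in> nonzero_columns R"
    proof (rule ccontr)
      assume "j \<notin> nonzero_columns R"
      then have "R $ i $ i = 0" for i
        using max[of i] diag0[of j] pos_semidef_diag_nonneg[OF R, of i] by simp
      then have "column i R = 0" for i
        using diag0[of i] by (simp add: nonzero_columns_def matrix_vector_mult_basis)
      then have "R = 0" by (simp add: vec_eq_iff column_def)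
      with that show False by simp
    qed
    moreover have "j \<notin> nonzero_columns (SR1 R 0 u)"
      using SR1_0_mult_eq_0[OF R, of u] by (simp add: nonzero_columns_def j)
    moreover have "nonzero_columns (SR1 R 0 u) \<subseteq> nonzero_columns R"
      using SR1_0_mult_eq_0_mono[OF sym, of _ u] by (auto simp: nonzero_columns_def)
    ultimately show ?thesis by (intro psubset_card_mono) auto
  qed
  show "trace (SR1 R 0 u) \<le> (1 - 1 / real r) * trace R" if r: "card (nonzero_columns R) \<le> r"
  proof -
    have "trace R = (\<Sum>i\<in>nonzero_columns R. R $ i $ i)"
      unfolding trace_def by (intro sum.mono_neutral_right) (auto simp: diag0)
    also have "\<dots> \<le> real (card (nonzero_columns R)) * R $ j $ j"
      using sum_mono[of "nonzero_columns R" "\<lambda>i. R $ i $ i" "\<lambda>_. R $ j $ j"] max by simp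
    also have "\<dots> \<le> real r * R $ j $ j"
      using r jj by (intro mult_right_mono) auto
    finally have *: "trace R \<le> real r * R $ j $ j" .
    \<comment> \<open>For \<open>r = 0\<close> the quotient is 0 by the convention for division, and
      nonnegativity of the diagonal suffices.\<close>
    then have "trace R / real r \<le> R $ j $ j"
      using jj by (cases "r = 0") (auto simp: divide_simps mult.commute)
    also have "R $ j $ j \<le> ((R *v u) \<bullet> (R *v u)) / (u \<bullet> (R *v u))"
    proof (cases "R $ j $ j = 0")
      case False
      have "(R $ j $ j)\<^sup>2 = (u \<bullet> (R *v u))\<^sup>2"
        by (simp add: j axis_quadratic_form)
      also have "\<dots> \<le> (norm u * norm (R *v u))\<^sup>2"
        by (metis Cauchy_Schwarz_ineq2 abs_le_square_iff abs_mult abs_norm_cancel)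
      also have "\<dots> = (R *v u) \<bullet> (R *v u)"
        by (simp add: j power2_norm_eq_inner)
      finally show ?thesis
        using False jj by (simp add: j axis_quadratic_form power2_eq_square field_simps)
    qed (simp add: j axis_quadratic_form)
    finally show ?thesis
      by (simp add: trace_SR1_0[OF sym] algebra_simps)
  qed
qed

subsection \<open>Isotropic laws\<close>

text \<open>The uniqueness argument for Haar measure: integrate \<open>f x * g y\<close> over the product of the two
  measures, with \<open>f\<close> the indicator of the unit ball (which is symmetric), shear by translations,
  and apply Fubini. The orthogonal change of variables of the library would need a well-ordered
  index type.\<close>

lemma lborel_eqI_translation_invariant:
  fixes \<mu> :: "'a::euclidean_space measure"
  assumes sets [measurable_cong]: "sets \<mu> = sets borel" and "sigma_finite_measure \<mu>"
    and trans: "\<And>c. distr \<mu> borel ((+) c) = \<mu>"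
    and ball: "emeasure \<mu> (ball 0 1) = emeasure lborel (ball (0 :: 'a) 1)"
  shows "\<mu> = lborel"
proof (rule measure_eqI)
  fix S assume "S \<in> sets \<mu>"
  then have [measurable]: "S \<in> sets borel" by (simp add: sets)
  interpret \<mu>: sigma_finite_measure \<mu> by fact
  interpret P: pair_sigma_finite \<mu> lborel ..
  define f g :: "'a \<Rightarrow> ennreal" where "f = indicator (ball 0 1)" and "g = indicator S"
  have [measurable]: "f \<in> borel_measurable borel" "g \<in> borel_measurable borel"
    by (auto simp: f_def g_def intro!: borel_measurable_indicator)
  have ints: "integral\<^sup>N \<mu> f = emeasure lborel (ball (0 :: 'a) 1)"
    "integral\<^sup>N lborel f = emeasure lborel (ball (0 :: 'a) 1)"
    "integral\<^sup>N \<mu> g = emeasure \<mu> S" "integral\<^sup>N lborel g = emeasure lborel S"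
    by (simp_all add: f_def g_def sets ball)
  have shift_\<mu>: "(\<integral>\<^sup>+x. h (c + x) \<partial>\<mu>) = (\<integral>\<^sup>+x. h x \<partial>\<mu>)"
    if [measurable]: "h \<in> borel_measurable borel" for h :: "'a \<Rightarrow> ennreal" and c
  proof -
    have "(\<integral>\<^sup>+x. h x \<partial>\<mu>) = (\<integral>\<^sup>+x. h x \<partial>distr \<mu> borel ((+) c))"
      by (simp only: trans)
    then show ?thesis by (simp add: nn_integral_distr)
  qed
  have shift: "(\<integral>\<^sup>+x. h (c + x) \<partial>lborel) = (\<integral>\<^sup>+x. h x \<partial>lborel)"
    if [measurable]: "h \<in> borel_measurable borel" for h :: "'a \<Rightarrow> ennreal" and c
  proof -
    have "(\<integral>\<^sup>+x. h x \<partial>lborel) = (\<integral>\<^sup>+x. h x \<partial>distr lborel borel ((+) c))"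
      by (simp only: lborel_distr_plus)
    then show ?thesis by (simp add: nn_integral_distr)
  qed
  have "emeasure lborel (ball (0 :: 'a) 1) * emeasure lborel S
      = (\<integral>\<^sup>+x. \<integral>\<^sup>+y. f x * g y \<partial>lborel \<partial>\<mu>)"
    by (simp add: nn_integral_cmult nn_integral_multc ints)
  also have "\<dots> = (\<integral>\<^sup>+x. \<integral>\<^sup>+y. f x * g (x + y) \<partial>lborel \<partial>\<mu>)"
  proof (rule nn_integral_cong)
    show "(\<integral>\<^sup>+y. f x * g y \<partial>lborel) = (\<integral>\<^sup>+y. f x * g (x + y) \<partial>lborel)" for x
      by (rule shift[of "\<lambda>y. f x * g y", symmetric]) measurable
  qed
  also have "\<dots> = (\<integral>\<^sup>+y. \<integral>\<^sup>+x. f x * g (x + y) \<partial>\<mu> \<partial>lborel)"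
    by (rule P.Fubini'[symmetric]) measurable
  also have "\<dots> = (\<integral>\<^sup>+y. \<integral>\<^sup>+x. f (- y + x) * g x \<partial>\<mu> \<partial>lborel)"
  proof (rule nn_integral_cong)
    fix y
    have "(\<integral>\<^sup>+x. f x * g (x + y) \<partial>\<mu>) = (\<integral>\<^sup>+x. f (- y + x) * g (- y + x + y) \<partial>\<mu>)"
      by (rule shift_\<mu>[of "\<lambda>x. f x * g (x + y)", symmetric]) measurable
    then show "(\<integral>\<^sup>+x. f x * g (x + y) \<partial>\<mu>) = (\<integral>\<^sup>+x. f (- y + x) * g x \<partial>\<mu>)"
      by simp
  qed
  also have "\<dots> = (\<integral>\<^sup>+x. \<integral>\<^sup>+y. f (- y + x) * g x \<partial>lborel \<partial>\<mu>)"
    by (rule P.Fubini') measurable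
  also have "\<dots> = (\<integral>\<^sup>+x. \<integral>\<^sup>+y. f y * g x \<partial>lborel \<partial>\<mu>)"
  proof (rule nn_integral_cong)
    fix x
    have "(\<integral>\<^sup>+y. f (- y + x) * g x \<partial>lborel) = (\<integral>\<^sup>+y. f (- (x + y) + x) * g x \<partial>lborel)"
      by (rule shift[of "\<lambda>y. f (- y + x) * g x", symmetric]) measurable
    also have "\<dots> = (\<integral>\<^sup>+y. f y * g x \<partial>lborel)"
      by (simp add: f_def indicator_def)
    finally show "(\<integral>\<^sup>+y. f (- y + x) * g x \<partial>lborel) = (\<integral>\<^sup>+y. f y * g x \<partial>lborel)" .
  qed
  also have "\<dots> = emeasure lborel (ball (0 :: 'a) 1) * emeasure \<mu> S"
    by (simp add: nn_integral_cmult nn_integral_multc ints)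
  finally have *: "emeasure lborel (ball (0 :: 'a) 1) * emeasure lborel S
    = emeasure lborel (ball (0 :: 'a) 1) * emeasure \<mu> S" .
  \<comment> \<open>Cancelling the ball in \<open>ennreal\<close> requires its measure to be neither
    infinite nor zero.\<close>
  have "emeasure lborel (ball (0 :: 'a) 1) \<noteq> \<infinity>"
    using emeasure_bounded_finite[OF bounded_ball, of "0 :: 'a" 1] by auto
  moreover have "measure lborel (ball (0 :: 'a) 1) > 0"
    by (intro content_ball_pos) simp
  then have "emeasure lborel (ball (0 :: 'a) 1) \<noteq> 0"
    by (auto simp: measure_def)
  ultimately show "emeasure \<mu> S = emeasure lborel S"
    using * by (auto simp: ennreal_mult_cancel_left)
qed (simp add: sets)

section \<open>Orthogonal invariance of Lebesgue measure and of the two direction laws\<close>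

lemma orthogonal_transformation_borel_measurable:
  fixes f :: "'a::euclidean_space \<Rightarrow> 'a"
  assumes "orthogonal_transformation f"
  shows "f \<in> borel_measurable borel"
  by (intro borel_measurable_continuous_onI linear_continuous_on)
    (simp add: assms linear_linear orthogonal_transformation_linear)

text \<open>Translating by \<open>f b\<close> after \<open>f\<close> is the same as translating by
  \<open>b\<close> before \<open>f\<close>, so the image measure is translation invariant. Balls
  around 0 keep their measure because \<open>f\<close> preserves norms; this also gives
  sigma-finiteness.\<close>

lemma distr_orthogonal_lborel:
  fixes f :: "'a::euclidean_space \<Rightarrow> 'a"
  assumes f: "orthogonal_transformation f"
  shows "distr lborel borel f = lborel"
proof (rule lborel_eqI_translation_invariant)
  have [measurable]: "f \<in> borel_measurable borel"
    by (rule orthogonal_transformation_borel_measurable[OF f])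
  have ball: "emeasure (distr lborel borel f) (ball 0 r) = emeasure lborel (ball (0 :: 'a) r)" for r
    by (subst emeasure_distr)
      (auto intro!: arg_cong[where f = "emeasure lborel"] simp: orthogonal_transformation_norm[OF f])
  then show "emeasure (distr lborel borel f) (ball 0 1) = emeasure lborel (ball (0 :: 'a) 1)" .
  show "sigma_finite_measure (distr lborel borel f)"
  proof (standard, intro exI[of _ "range (\<lambda>n. ball 0 (real n))"] conjI ballI)
    show "\<Union> (range (\<lambda>n. ball 0 (real n))) = space (distr lborel borel f)"
      by (auto simp: reals_Archimedean2)
    show "emeasure (distr lborel borel f) a \<noteq> \<infinity>" if "a \<in> range (\<lambda>n. ball 0 (real n))" for a
      using that ball emeasure_bounded_finite[OF bounded_ball, of "0 :: 'a"] by (auto simp: less_top)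
  qed auto
  show "distr (distr lborel borel f) borel ((+) c) = distr lborel borel f" for c
  proof -
    obtain b where b: "c = f b" using orthogonal_transformation_surj[OF f] by (metis surjD)
    have "distr (distr lborel borel f) borel ((+) c) = distr lborel borel (f \<circ> (+) b)"
      using linear_add[OF orthogonal_transformation_linear[OF f]]
      by (subst distr_distr) (auto simp: b o_def)
    also have "\<dots> = distr (distr lborel borel ((+) b)) borel f"
      by (subst distr_distr) auto
    finally show ?thesis by (simp add: lborel_distr_plus)
  qed
qed simp

lemma AE_lborel_hyperplane:
  fixes a :: "'a::euclidean_space"
  assumes "a \<noteq> 0"
  shows "AE x in lborel. a \<bullet> x \<noteq> 0"
proof -
  have "negligible {x. a \<bullet> x = 0}"
    using assms by (intro negligible_hyperplane) auto
  then have "{x. a \<bullet> x = 0} \<in> null_sets lebesgue"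
    by (simp add: negligible_iff_null_sets)
  then have "AE x in lebesgue. a \<bullet> x \<noteq> 0"
    by (rule AE_I') auto
  then show ?thesis
    by (simp add: AE_completion_iff)
qed

text \<open>The two properties that the normal and the spherical law share: invariance determines
  the averages, and null hyperplanes make \<open>R *v x\<close> nonzero almost surely for a fixed
  \<open>R \<noteq> 0\<close>.\<close>

locale isotropic_law = prob_space \<nu> for \<nu> :: "'a::euclidean_space measure" +
  assumes sets_eq_borel [measurable_cong, simp]: "sets \<nu> = sets borel"
    and distr_orthogonal: "orthogonal_transformation f \<Longrightarrow> distr \<nu> borel f = \<nu>"
    and AE_not_orthogonal: "a \<noteq> 0 \<Longrightarrow> AE x in \<nu>. a \<bullet> x \<noteq> 0"

lemma prod_std_normal_density:
  "(\<Prod>i\<in>UNIV. std_normal_density (x $ i))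
    = (1 / sqrt (2 * pi)) ^ CARD('n) * exp (- (norm (x :: real^'n))\<^sup>2 / 2)"
proof -
  have "(norm x)\<^sup>2 = (\<Sum>i\<in>UNIV. (x $ i)\<^sup>2)"
    unfolding power2_norm_eq_inner by (simp add: inner_vec_def power2_eq_square)
  then show ?thesis
    by (simp add: std_normal_density_def exp_sum[symmetric] sum_negf sum_divide_distrib prod_dividef
        power_divide)
qed

lemma std_normal_vec_eq_density:
  "(std_normal_vec :: (real^'n) measure) = density lborel
    (\<lambda>x. ennreal ((1 / sqrt (2 * pi)) ^ CARD('n) * exp (- (norm x)\<^sup>2 / 2)))"
  by (simp only: std_normal_vec_def prod_std_normal_density)

text \<open>Used for densities that depend on the norm only: the Gaussian one and that of the
  uniform law on the ball.\<close>

lemma distr_density_orthogonal: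
  fixes f :: "'a::euclidean_space \<Rightarrow> 'a"
  assumes f: "orthogonal_transformation f" and [measurable]: "g \<in> borel_measurable borel"
    and g: "\<And>x. g (f x) = g x"
  shows "distr (density lborel g) borel f = density lborel g"
proof -
  have [measurable]: "f \<in> borel_measurable borel"
    by (rule orthogonal_transformation_borel_measurable[OF f])
  have "distr (density lborel (\<lambda>x. g (f x))) borel f = density (distr lborel borel f) g"
    by (rule density_distr[symmetric]) measurable
  then show ?thesis unfolding g distr_orthogonal_lborel[OF f] .
qed

text \<open>Total mass 1 is assumed here; it is supplied later by the fact that this is the law of a
  random direction.\<close>

lemma isotropic_law_std_normal_vec:
  assumes "prob_space (std_normal_vec :: (real^'n) measure)"
  shows "isotropic_law (std_normal_vec :: (real^'n) measure)"
proof -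
  interpret prob_space "std_normal_vec :: (real^'n) measure" by fact
  show ?thesis
  proof
    show "distr std_normal_vec borel f = std_normal_vec" if "orthogonal_transformation f"
      for f :: "real^'n \<Rightarrow> real^'n"
      unfolding std_normal_vec_eq_density
      by (rule distr_density_orthogonal[OF that]) (auto simp: orthogonal_transformation_norm[OF that])
    show "AE x in std_normal_vec. a \<bullet> x \<noteq> 0" if "a \<noteq> 0" for a :: "real^'n"
      unfolding std_normal_vec_eq_density using AE_lborel_hyperplane[OF that] by (simp add: AE_density)
  qed (simp add: std_normal_vec_def)
qed

text \<open>Orthogonal maps commute with the radial projection, and the projection moves no point
  off the hyperplane into it, so both properties descend from the ball.\<close>

lemma isotropic_law_unif_sphere: "isotropic_law (unif_sphere :: (real^'n) measure)"
proof -
  interpret prob_space "unif_sphere :: (real^'n) measure" by (rule prob_space_unif_sphere)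
  let ?U = "uniform_measure lborel (ball (0 :: real^'n) 1)"
  have [simp, measurable_cong]: "sets ?U = sets borel" by (simp add: uniform_measure_def)
  show ?thesis
  proof
    show "distr unif_sphere borel f = unif_sphere" if f: "orthogonal_transformation f"
      for f :: "real^'n \<Rightarrow> real^'n"
    proof -
      have [measurable]: "f \<in> borel_measurable borel"
        by (rule orthogonal_transformation_borel_measurable[OF f])
      have "distr unif_sphere borel f = distr (distr ?U borel f) borel (\<lambda>x. x /\<^sub>R norm x)"
        unfolding unif_sphere_def
        by (simp add: distr_distr o_def orthogonal_transformation_scaleR[OF f]
            orthogonal_transformation_norm[OF f])
      also have "distr ?U borel f = ?U"
        unfolding uniform_measure_def
        by (rule distr_density_orthogonal[OF f])
          (auto simp: orthogonal_transformation_norm[OF f] indicator_def)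
      finally show ?thesis by (simp add: unif_sphere_def)
    qed
    show "AE x in unif_sphere. a \<bullet> x \<noteq> 0" if "a \<noteq> 0" for a :: "real^'n"
    proof -
      have "AE x in ?U. a \<bullet> x \<noteq> 0"
        using AE_lborel_hyperplane[OF that] by (intro AE_uniform_measureI) auto
      then have "AE x in ?U. a \<bullet> (x /\<^sub>R norm x) \<noteq> 0"
        by eventually_elim auto
      then show ?thesis
        unfolding unif_sphere_def by (subst AE_distr_iff) auto
    qed
  qed (simp add: unif_sphere_def)
qed

subsection \<open>The average decrease of the trace\<close>

text \<open>The reflection in the hyperplane orthogonal to \<open>w\<close>. For
  \<open>w = 0\<close> it is the identity, so it is orthogonal for every \<open>w\<close>.\<close>

definition householder :: "'a::real_inner \<Rightarrow> 'a \<Rightarrow> 'a" where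
  "householder w x = x - (2 * (w \<bullet> x) / (w \<bullet> w)) *\<^sub>R w"

lemma inner_householder: "e \<bullet> householder w x = e \<bullet> x - 2 * (w \<bullet> x) * (e \<bullet> w) / (w \<bullet> w)"
  by (simp add: householder_def inner_diff_right)

lemma orthogonal_transformation_householder: "orthogonal_transformation (householder w)"
proof -
  have "linear (householder w)"
    by (rule linearI) (simp_all add: householder_def algebra_simps inner_add_right add_divide_distrib)
  moreover have "householder w x \<bullet> householder w y = x \<bullet> y" for x y
    by (cases "w = 0")
      (simp_all add: householder_def inner_diff_left inner_diff_right inner_commute field_simps)
  ultimately show ?thesis by (simp add: orthogonal_transformation_def)
qed

text \<open>The expansion of \<open>v\<close> in \<open>B\<close> is linear in \<open>v\<close> and
  correct on \<open>B\<close>, hence on its span. The vector \<open>y\<close> may lie outside the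
  span, so \<open>b \<bullet> y\<close> are the coordinates of its projection.\<close>

lemma orthonormal_expansion:
  fixes B :: "'a::real_inner set"
  assumes "finite B" and on: "\<And>b c. b \<in> B \<Longrightarrow> c \<in> B \<Longrightarrow> b \<bullet> c = (if b = c then 1 else 0)"
    and "v \<in> span B"
  shows "y \<bullet> v = (\<Sum>b\<in>B. (b \<bullet> v) * (b \<bullet> y))"
proof -
  have "v = (\<Sum>b\<in>B. (b \<bullet> v) *\<^sub>R b)"
  proof (rule linear_eq_on_span[where f = "\<lambda>v. v" and g = "\<lambda>v. \<Sum>b\<in>B. (b \<bullet> v) *\<^sub>R b" and B = B])
    show "linear (\<lambda>v. \<Sum>b\<in>B. (b \<bullet> v) *\<^sub>R b)"
      by (rule linearI)
        (simp_all add: inner_add_right scaleR_add_left sum.distrib scaleR_sum_right)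
    fix c assume "c \<in> B"
    then have "(\<Sum>b\<in>B. (b \<bullet> c) *\<^sub>R b) = (\<Sum>b\<in>B. if b = c then b else 0)"
      by (intro sum.cong) (simp_all add: on)
    then show "c = (\<Sum>b\<in>B. (b \<bullet> c) *\<^sub>R b)" using \<open>c \<in> B\<close> \<open>finite B\<close> by simp
  qed (simp_all add: \<open>v \<in> span B\<close> linear_ident)
  then have "y \<bullet> v = y \<bullet> (\<Sum>b\<in>B. (b \<bullet> v) *\<^sub>R b)" by (rule arg_cong)
  then show ?thesis by (simp add: inner_sum_right inner_commute)
qed

text \<open>\<open>B\<close> need only span the range: each \<open>R *v axis i 1\<close> is expanded
  in \<open>B\<close>, and exchanging the sums collects the quadratic forms.\<close>

lemma trace_eq_sum_orthonormal:
  fixes R :: "real^'n^'n"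
  assumes sym: "transpose R = R" and B: "finite B" "\<And>b c. b \<in> B \<Longrightarrow> c \<in> B \<Longrightarrow> b \<bullet> c = (if b = c then 1 else 0)"
    and range: "range ((*v) R) \<subseteq> span B"
  shows "trace R = (\<Sum>b\<in>B. b \<bullet> (R *v b))"
proof -
  have "trace R = (\<Sum>i\<in>UNIV. axis i 1 \<bullet> (R *v axis i 1))"
    unfolding axis_quadratic_form by (simp add: trace_def)
  also have "\<dots> = (\<Sum>i\<in>UNIV. \<Sum>b\<in>B. (R *v b) $ i * b $ i)"
  proof (rule sum.cong)
    fix i :: 'n
    have "R *v axis i 1 \<in> span B" using range by auto
    then have "axis i 1 \<bullet> (R *v axis i 1) = (\<Sum>b\<in>B. (b \<bullet> (R *v axis i 1)) * (b \<bullet> axis i 1))"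
      using B by (intro orthonormal_expansion)
    also have "\<dots> = (\<Sum>b\<in>B. (R *v b) $ i * b $ i)"
      by (simp add: inner_matrix_vector_symmetric[OF sym] inner_axis)
    finally show "axis i 1 \<bullet> (R *v axis i 1) = (\<Sum>b\<in>B. (R *v b) $ i * b $ i)" .
  qed simp
  also have "\<dots> = (\<Sum>b\<in>B. b \<bullet> (R *v b))"
    by (subst sum.swap) (simp add: inner_vec_def mult.commute)
  finally show ?thesis .
qed

context isotropic_law
begin

lemma integral_orthogonal:
  fixes h :: "'a \<Rightarrow> real"
  assumes f: "orthogonal_transformation f" and [measurable]: "h \<in> borel_measurable borel"
  shows "(\<integral>x. h (f x) \<partial>\<nu>) = (\<integral>x. h x \<partial>\<nu>)"
proof -
  have [measurable]: "f \<in> borel_measurable borel"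
    by (rule orthogonal_transformation_borel_measurable[OF f])
  have "(\<integral>x. h x \<partial>distr \<nu> borel f) = (\<integral>x. h (f x) \<partial>\<nu>)"
    by (rule integral_distr) measurable
  then show ?thesis by (simp add: distr_orthogonal[OF f])
qed

text \<open>\<open>D x\<close> is the squared norm of the projection of \<open>x\<close> onto the
  span of \<open>B\<close>. Flipping the sign of \<open>b\<close> turns an off-diagonal integral
  into its negative, swapping two basis vectors equates the diagonal ones, and the diagonal
  integrands add up to 1 almost everywhere.\<close>

lemma integral_orthonormal_products:
  fixes B :: "'a set"
  assumes B: "finite B" "B \<noteq> {}"
    and on: "\<And>b c. b \<in> B \<Longrightarrow> c \<in> B \<Longrightarrow> b \<bullet> c = (if b = c then 1 else 0)"
    and bc: "b \<in> B" "c \<in> B"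
  defines "D \<equiv> \<lambda>x. \<Sum>b\<in>B. (b \<bullet> x)\<^sup>2"
  shows "integrable \<nu> (\<lambda>x. (b \<bullet> x) * (c \<bullet> x) / D x)"
    and "(\<integral>x. (b \<bullet> x) * (c \<bullet> x) / D x \<partial>\<nu>) = (if b = c then 1 / card B else 0)"
proof -
  have [measurable]: "D \<in> borel_measurable borel" unfolding D_def by measurable
  have D_ge: "(b \<bullet> x)\<^sup>2 \<le> D x" if "b \<in> B" for b x
    unfolding D_def by (rule member_le_sum[OF that]) (auto simp: B)
  have D0: "0 \<le> D x" for x by (auto simp: D_def intro: sum_nonneg)
  have int: "integrable \<nu> (\<lambda>x. (b \<bullet> x) * (c \<bullet> x) / D x)" if "b \<in> B" "c \<in> B" for b c
  proof (rule integrable_const_bound)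
    \<comment> \<open>Each coordinate is at most \<open>sqrt (D x)\<close> in absolute value; where
      \<open>D x = 0\<close> the quotient is 0.\<close>
    have "\<bar>(b \<bullet> x) * (c \<bullet> x) / D x\<bar> \<le> 1" for x
    proof -
      have "\<bar>b \<bullet> x\<bar> * \<bar>c \<bullet> x\<bar> \<le> sqrt (D x) * sqrt (D x)"
        using D_ge that by (intro mult_mono real_le_rsqrt) (auto simp: D0)
      then show ?thesis using D0[of x] by (auto simp: abs_mult divide_simps)
    qed
    then show "AE x in \<nu>. norm ((b \<bullet> x) * (c \<bullet> x) / D x) \<le> 1" by simp
  qed measurable
  show "integrable \<nu> (\<lambda>x. (b \<bullet> x) * (c \<bullet> x) / D x)" using int bc .
  have off: "(\<integral>x. (b \<bullet> x) * (c \<bullet> x) / D x \<partial>\<nu>) = 0" if "b \<in> B" "c \<in> B" "b \<noteq> c" for b c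
  proof -
    have e: "e \<bullet> householder b x = (if e = b then - (b \<bullet> x) else e \<bullet> x)" if "e \<in> B" for e x
      using on[OF \<open>b \<in> B\<close> \<open>b \<in> B\<close>] on[OF that \<open>b \<in> B\<close>] by (simp add: inner_householder)
    have "D (householder b x) = D x" for x
      unfolding D_def by (intro sum.cong) (auto simp: e)
    then have "(\<integral>x. (b \<bullet> x) * (c \<bullet> x) / D x \<partial>\<nu>) = (\<integral>x. - ((b \<bullet> x) * (c \<bullet> x) / D x) \<partial>\<nu>)"
      using that by (subst integral_orthogonal[OF orthogonal_transformation_householder[of b], symmetric])
        (auto simp: e)
    then show ?thesis by simp
  qed
  have swap: "(\<integral>x. (b \<bullet> x) * (b \<bullet> x) / D x \<partial>\<nu>) = (\<integral>x. (c \<bullet> x) * (c \<bullet> x) / D x \<partial>\<nu>)"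
    if "b \<in> B" "c \<in> B" "b \<noteq> c" for b c
  proof -
    \<comment> \<open>For orthonormal \<open>b\<close> and \<open>c\<close> the reflection along \<open>b - c\<close> swaps them.\<close>
    define H where "H = householder (b - c)"
    have w: "(b - c) \<bullet> (b - c) = 2"
      using on that by (simp add: inner_diff_left inner_diff_right)
    have e: "e \<bullet> H x = (if e = b then c \<bullet> x else if e = c then b \<bullet> x else e \<bullet> x)" if "e \<in> B" for e x
      using on that \<open>b \<in> B\<close> \<open>c \<in> B\<close> \<open>b \<noteq> c\<close>
      by (simp add: H_def inner_householder w inner_diff_right inner_diff_left diff_divide_distrib)
    have "D (H x) = D x" for x
      unfolding D_def
      by (rule sum.reindex_bij_witness[where i = "\<lambda>e. if e = b then c else if e = c then b else e"
            and j = "\<lambda>e. if e = b then c else if e = c then b else e"])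
        (use that in \<open>auto simp: e\<close>)
    then show ?thesis
      using that by (subst integral_orthogonal[OF orthogonal_transformation_householder[of "b - c"], symmetric])
        (auto simp: e H_def[symmetric])
  qed
  show "(\<integral>x. (b \<bullet> x) * (c \<bullet> x) / D x \<partial>\<nu>) = (if b = c then 1 / card B else 0)"
  proof (cases "b = c")
    case True
    \<comment> \<open>Off the null hyperplane orthogonal to \<open>b\<close> the denominator is
      positive and the sum is \<open>D x / D x\<close>.\<close>
    have "AE x in \<nu>. (\<Sum>e\<in>B. (e \<bullet> x) * (e \<bullet> x) / D x) = 1"
    proof -
      have "b \<noteq> 0" using on[OF bc(1) bc(1)] by auto
      from AE_not_orthogonal[OF this] show ?thesis
      proof eventually_elim
        case (elim x)
        then have "D x > 0"
          using D_ge[OF bc(1), of x] by (auto intro: less_le_trans[of 0 "(b \<bullet> x)\<^sup>2"])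
        moreover have "(\<Sum>e\<in>B. (e \<bullet> x) * (e \<bullet> x) / D x) = (\<Sum>e\<in>B. (e \<bullet> x)\<^sup>2) / D x"
          by (simp only: sum_divide_distrib power2_eq_square)
        then have "(\<Sum>e\<in>B. (e \<bullet> x) * (e \<bullet> x) / D x) = D x / D x"
          by (simp only: D_def)
        ultimately show ?case by simp
      qed
    qed
    then have "(\<integral>x. (\<Sum>e\<in>B. (e \<bullet> x) * (e \<bullet> x) / D x) \<partial>\<nu>) = (\<integral>x. 1 \<partial>\<nu>)"
      by (intro integral_cong_AE) auto
    then have "1 = (\<Sum>e\<in>B. \<integral>x. (e \<bullet> x) * (e \<bullet> x) / D x \<partial>\<nu>)"
      by (simp add: int prob_space)
    also have "\<dots> = (\<Sum>e\<in>B. \<integral>x. (b \<bullet> x) * (b \<bullet> x) / D x \<partial>\<nu>)"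
      using swap[OF bc(1)] by (intro sum.cong) (auto, metis)
    finally show ?thesis using True B by (simp add: field_simps)
  qed (use off bc in auto)
qed

end

text \<open>The integrand is the trace drop for a fixed residual. It dominates
  \<open>(x \<bullet> (R *v x)) / D x\<close>, whose integral is \<open>trace R / card B\<close> by
  the isotropy of the projected direction. The nonnegative integral on the right fits the later use
  of Tonelli.\<close>

lemma expected_trace_decrease:
  fixes R :: "real^'n^'n"
  assumes "isotropic_law (\<nu> :: (real^'n) measure)"
  assumes R: "pos_semidef R" and r: "dim (range ((*v) R)) \<le> r"
  shows "ennreal (trace R / r) \<le> (\<integral>\<^sup>+x. ennreal (((R *v x) \<bullet> (R *v x)) / (x \<bullet> (R *v x))) \<partial>\<nu>)"
proof (cases "R = 0")
  case True
  then show ?thesis by (simp add: trace_def)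
next
  case False
  interpret N: isotropic_law \<nu> by fact
  have sym: "transpose R = R" and nn: "\<And>x. 0 \<le> x \<bullet> (R *v x)"
    using R by (auto simp: pos_semidef_def)
  have "subspace (range ((*v) R))" by (simp add: linear_subspace_image)
  from orthonormal_basis_subspace[OF this] obtain B where
    B: "pairwise orthogonal B" "\<And>x. x \<in> B \<Longrightarrow> norm x = 1" "independent B"
      "card B = dim (range ((*v) R))" "span B = range ((*v) R)"
    by metis
  have fin: "finite B" using B(3) by (rule independent_imp_finite)
  have ne: "B \<noteq> {}"
    using range_mult_vector_dim_0[of R] False B(4) by auto
  have on: "b \<bullet> c = (if b = c then 1 else 0)" if "b \<in> B" "c \<in> B" for b c
    using B(1,2) that by (auto simp: pairwise_def orthogonal_def norm_eq_1)
  define D where "D x = (\<Sum>b\<in>B. (b \<bullet> x)\<^sup>2)" for x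
  note prods = N.integral_orthonormal_products[OF fin ne on, folded D_def]
  have expand: "y \<bullet> (R *v x) = (\<Sum>b\<in>B. (b \<bullet> (R *v x)) * (b \<bullet> y))" for x y
    using B(5) by (intro orthonormal_expansion[OF fin on]) auto
  \<comment> \<open>Writing the form in the basis \<open>B\<close> reduces its integral to those of
    the coordinate products.\<close>
  have quad: "(x \<bullet> (R *v x)) / D x = (\<Sum>b\<in>B. \<Sum>c\<in>B. (c \<bullet> (R *v b)) * ((b \<bullet> x) * (c \<bullet> x) / D x))" for x
  proof -
    have "x \<bullet> (R *v x) = (\<Sum>b\<in>B. (b \<bullet> (R *v x)) * (b \<bullet> x))"
      by (rule expand)
    also have "\<dots> = (\<Sum>b\<in>B. (x \<bullet> (R *v b)) * (b \<bullet> x))"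
      by (intro sum.cong refl arg_cong2[where f = "(*)"])
        (metis inner_matrix_vector_symmetric[OF sym] inner_commute)
    also have "\<dots> = (\<Sum>b\<in>B. \<Sum>c\<in>B. (c \<bullet> (R *v b)) * (c \<bullet> x) * (b \<bullet> x))"
      by (simp only: expand[of x] sum_distrib_right)
    finally show ?thesis by (simp add: sum_divide_distrib mult_ac)
  qed
  have int: "integrable \<nu> (\<lambda>x. (x \<bullet> (R *v x)) / D x)"
    unfolding quad using prods(1) by (intro Bochner_Integration.integrable_sum integrable_mult_right) auto
  have "(\<integral>x. (x \<bullet> (R *v x)) / D x \<partial>\<nu>)
      = (\<Sum>b\<in>B. \<Sum>c\<in>B. (c \<bullet> (R *v b)) * (\<integral>x. (b \<bullet> x) * (c \<bullet> x) / D x \<partial>\<nu>))"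
    unfolding quad using prods(1)
    by (simp add: Bochner_Integration.integrable_sum del: times_divide_eq_right times_divide_eq_left)
  also have "\<dots> = (\<Sum>b\<in>B. \<Sum>c\<in>B. if b = c then (b \<bullet> (R *v b)) / card B else 0)"
    by (intro sum.cong refl) (auto simp: prods(2))
  also have "\<dots> = trace R / card B"
    using trace_eq_sum_orthonormal[OF sym fin on] B(5) by (simp add: fin sum_divide_distrib)
  finally have E: "(\<integral>x. (x \<bullet> (R *v x)) / D x \<partial>\<nu>) = trace R / card B" .
  have D0: "0 \<le> D x" for x by (auto simp: D_def intro: sum_nonneg)
  \<comment> \<open>As \<open>R *v x\<close> lies in the span of \<open>B\<close>, only the
    projection of \<open>x\<close> enters \<open>x \<bullet> (R *v x)\<close>, and Cauchy-Schwarz in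
    coordinates applies. If a denominator is 0, the left side is 0 and the right side
    nonnegative.\<close>
  have le: "(x \<bullet> (R *v x)) / D x \<le> ((R *v x) \<bullet> (R *v x)) / (x \<bullet> (R *v x))" for x
  proof (cases "x \<bullet> (R *v x) = 0 \<or> D x = 0")
    case True
    then show ?thesis using nn[of x] by auto
  next
    case False
    have "(x \<bullet> (R *v x))\<^sup>2 = (\<Sum>b\<in>B. (b \<bullet> (R *v x)) * (b \<bullet> x))\<^sup>2"
      by (simp only: expand[of x x])
    also have "\<dots> \<le> (\<Sum>b\<in>B. (b \<bullet> (R *v x))\<^sup>2) * D x"
      unfolding D_def by (rule Cauchy_Schwarz_ineq_sum)
    also have "(\<Sum>b\<in>B. (b \<bullet> (R *v x))\<^sup>2) = (R *v x) \<bullet> (R *v x)"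
      by (simp only: expand[of "R *v x" x] power2_eq_square)
    finally show ?thesis
      using False nn[of x] D0[of x] by (simp add: field_simps power2_eq_square)
  qed
  have "0 < card B" using fin ne by (simp add: card_gt_0_iff)
  moreover have "card B \<le> r" using r B(4) by simp
  ultimately have "trace R / r \<le> trace R / card B"
    using pos_semidef_trace_nonneg[OF R] by (simp add: frac_le)
  then have "ennreal (trace R / r) \<le> ennreal (trace R / card B)" by (rule ennreal_leI)
  also have "\<dots> = (\<integral>\<^sup>+x. ennreal ((x \<bullet> (R *v x)) / D x) \<partial>\<nu>)"
    unfolding E[symmetric] using int D0 nn by (intro nn_integral_eq_integral[symmetric]) auto
  also have "\<dots> \<le> (\<integral>\<^sup>+x. ennreal (((R *v x) \<bullet> (R *v x)) / (x \<bullet> (R *v x))) \<partial>\<nu>)"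
    using le by (intro nn_integral_mono ennreal_leI)
  finally show ?thesis .
qed

subsection \<open>The residual process\<close>

lemma borel_measurable_matrix_vector_mult [measurable (raw)]:
  fixes R :: "'w \<Rightarrow> real^'n^'n"
  assumes "R \<in> borel_measurable M" "x \<in> borel_measurable M"
  shows "(\<lambda>\<omega>. R \<omega> *v x \<omega>) \<in> borel_measurable M"
  by (rule borel_measurable_continuous_Pair[OF assms])
    (simp add: matrix_vector_mult_def, intro continuous_intros)

lemma borel_measurable_trace [measurable (raw)]:
  fixes R :: "'w \<Rightarrow> real^'n^'n"
  assumes "R \<in> borel_measurable M"
  shows "(\<lambda>\<omega>. trace (R \<omega>)) \<in> borel_measurable M"
proof -
  have "trace \<in> borel_measurable (borel :: (real^'n^'n) measure)"
    unfolding trace_def by (intro borel_measurable_continuous_onI continuous_intros)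
  from measurable_compose[OF assms this] show ?thesis .
qed

lemma borel_measurable_SR1_0:
  fixes R :: "'w \<Rightarrow> real^'n^'n"
  assumes [measurable]: "R \<in> borel_measurable M" "x \<in> borel_measurable M"
  shows "(\<lambda>\<omega>. SR1 (R \<omega>) 0 (x \<omega>)) \<in> borel_measurable M"
proof -
  \<comment> \<open>The update is not continuous in general. Continuity serves only for this
    product; the quotient and the case distinction are handled by measurability.\<close>
  have [measurable]: "(\<lambda>\<omega>. R \<omega> ** outer (x \<omega>) (x \<omega>) ** R \<omega>) \<in> borel_measurable M"
    by (rule borel_measurable_continuous_Pair[OF assms])
      (simp add: matrix_matrix_mult_def outer_def, intro continuous_intros)
  show ?thesis unfolding SR1_def diff_zero by measurable
qed

text \<open>Independence from a sigma-algebra \<open>N\<close> for which \<open>X\<close> is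
  measurable makes the joint law of \<open>X\<close> and \<open>U\<close> a product, as seen on
  rectangles; Tonelli does the rest.\<close>

lemma (in prob_space) nn_integral_indep:
  fixes X :: "'a \<Rightarrow> 'b::second_countable_topology" and U :: "'a \<Rightarrow> 'c::second_countable_topology"
  assumes X [measurable]: "X \<in> borel_measurable M" and U [measurable]: "U \<in> borel_measurable M"
    and N: "X \<in> borel_measurable N" "space N = space M"
    and indep: "indep_set (sets (vimage_algebra (space M) U borel)) (sets N)"
    and h [measurable]: "case_prod h \<in> borel_measurable (borel \<Otimes>\<^sub>M borel)"
  shows "(\<integral>\<^sup>+\<omega>. h (X \<omega>) (U \<omega>) \<partial>M) = (\<integral>\<^sup>+\<omega>. \<integral>\<^sup>+x. h (X \<omega>) x \<partial>distr M borel U \<partial>M)"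
proof -
  interpret X: prob_space "distr M borel X" by (rule prob_space_distr) measurable
  interpret U: prob_space "distr M borel U" by (rule prob_space_distr) measurable
  have eq: "distr M borel X \<Otimes>\<^sub>M distr M borel U = distr M (borel \<Otimes>\<^sub>M borel) (\<lambda>\<omega>. (X \<omega>, U \<omega>))"
  proof (rule pair_measure_eqI)
    fix C D assume "C \<in> sets (distr M borel X)" "D \<in> sets (distr M borel U)"
    then have [measurable]: "C \<in> sets borel" "D \<in> sets borel" by auto
    have "prob ((U -` D \<inter> space M) \<inter> (X -` C \<inter> space M))
        = prob (U -` D \<inter> space M) * prob (X -` C \<inter> space M)"
      using measurable_sets[OF N(1), of C] N(2)
      by (intro indep_setD[OF indep] in_vimage_algebra) auto
    moreover have "(\<lambda>\<omega>. (X \<omega>, U \<omega>)) -` (C \<times> D) \<inter> space M = (U -` D \<inter> space M) \<inter> (X -` C \<inter> space M)"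
      by auto
    ultimately show "emeasure (distr M borel X) C * emeasure (distr M borel U) D
        = emeasure (distr M (borel \<Otimes>\<^sub>M borel) (\<lambda>\<omega>. (X \<omega>, U \<omega>))) (C \<times> D)"
      by (simp add: emeasure_distr emeasure_eq_measure ennreal_mult[symmetric] mult.commute)
  qed (simp_all add: X.sigma_finite_measure_axioms U.sigma_finite_measure_axioms)
  have "(\<integral>\<^sup>+\<omega>. h (X \<omega>) (U \<omega>) \<partial>M)
      = (\<integral>\<^sup>+p. case_prod h p \<partial>distr M (borel \<Otimes>\<^sub>M borel) (\<lambda>\<omega>. (X \<omega>, U \<omega>)))"
    by (subst nn_integral_distr) auto
  also have "\<dots> = (\<integral>\<^sup>+y. \<integral>\<^sup>+x. h y x \<partial>distr M borel U \<partial>distr M borel X)"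
    unfolding eq[symmetric] by (subst U.nn_integral_fst[symmetric]) auto
  also have "\<dots> = (\<integral>\<^sup>+\<omega>. \<integral>\<^sup>+x. h (X \<omega>) x \<partial>distr M borel U \<partial>M)"
    by (subst nn_integral_distr) auto
  finally show ?thesis .
qed

text \<open>The part of the setting common to both methods, with \<open>A\<close> absorbed into the
  residual and the choice of directions left open.\<close>

locale residual_process = prob_space M
  for M :: "'w measure" and R :: "nat \<Rightarrow> 'w \<Rightarrow> real^'n^'n" and u :: "nat \<Rightarrow> 'w \<Rightarrow> real^'n" +
  assumes R_0_measurable: "R 0 \<in> borel_measurable M"
    and R_0_pos_semidef: "\<omega> \<in> space M \<Longrightarrow> pos_semidef (R 0 \<omega>)"
    and u_measurable [measurable]: "u k \<in> borel_measurable M"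
    and R_Suc: "\<omega> \<in> space M \<Longrightarrow> R (Suc k) \<omega> = SR1 (R k \<omega>) 0 (u k \<omega>)"
    and integrable_0: "integrable M (\<lambda>\<omega>. trace (R 0 \<omega>))"
begin

lemma pos_semidef: "\<omega> \<in> space M \<Longrightarrow> pos_semidef (R k \<omega>)"
  by (induction k) (simp_all add: R_0_pos_semidef R_Suc pos_semidef_SR1_0)

text \<open>\<open>R k\<close> is built from \<open>R 0\<close> and the first \<open>k\<close>
  directions alone. With \<open>N\<close> the past of \<open>u k\<close>, this yields the
  independence of \<open>R k\<close> and \<open>u k\<close>.\<close>

lemma measurable_subalgebra:
  assumes "space N = space M" "R 0 \<in> borel_measurable N" "\<And>i. i < k \<Longrightarrow> u i \<in> borel_measurable N"
  shows "R k \<in> borel_measurable N"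
  using assms(3)
proof (induction k)
  case (Suc k)
  then have "(\<lambda>\<omega>. SR1 (R k \<omega>) 0 (u k \<omega>)) \<in> borel_measurable N"
    by (intro borel_measurable_SR1_0) auto
  then show ?case
    by (rule measurable_cong[THEN iffD1, rotated]) (simp add: assms(1) R_Suc)
qed (simp add: assms(2))

lemma R_measurable [measurable]: "R k \<in> borel_measurable M"
  by (rule measurable_subalgebra) (auto simp: R_0_measurable)

lemma trace_Suc_le: "\<omega> \<in> space M \<Longrightarrow> trace (R (Suc k) \<omega>) \<le> trace (R k \<omega>)"
  by (simp add: R_Suc trace_SR1_0_le pos_semidef)

lemma trace_nonneg: "\<omega> \<in> space M \<Longrightarrow> 0 \<le> trace (R k \<omega>)"
  by (simp add: pos_semidef pos_semidef_trace_nonneg)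

text \<open>Traces are nonnegative and do not increase, so each is dominated by its
  predecessor.\<close>

lemma integrable_trace: "integrable M (\<lambda>\<omega>. trace (R k \<omega>))"
proof (induction k)
  case (Suc k)
  show ?case
    by (rule Bochner_Integration.integrable_bound[OF Suc])
      (auto intro!: AE_I2 simp: trace_nonneg trace_Suc_le)
qed (rule integrable_0)

lemma expectation_trace_nonneg: "0 \<le> expectation (\<lambda>\<omega>. trace (R k \<omega>))"
  by (intro integral_nonneg_AE AE_I2 trace_nonneg)

lemma greedy_card_nonzero_columns:
  assumes "\<And>k. is_arg_max (\<lambda>v. v \<bullet> (R k \<omega> *v v)) (\<lambda>v. v \<in> range (\<lambda>i. axis i 1)) (u k \<omega>)"
    and \<omega>: "\<omega> \<in> space M"
  shows "card (nonzero_columns (R k \<omega>)) \<le> CARD('n) - k"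
proof (induction k)
  case 0
  show ?case using card_mono[of UNIV "nonzero_columns (R 0 \<omega>)"] by simp
next
  case (Suc k)
  show ?case
  \<comment> \<open>A zero residual stays zero; otherwise the strict decrease of the count
    applies.\<close>
  proof (cases "R k \<omega> = 0")
    case True
    then have "nonzero_columns (R (Suc k) \<omega>) = {}"
      by (simp add: nonzero_columns_def R_Suc[OF \<omega>] SR1_def)
    then show ?thesis by simp
  next
    case False
    from greedy_step(1)[OF pos_semidef[OF \<omega>] assms(1) False] Suc show ?thesis
      by (simp add: R_Suc[OF \<omega>])
  qed
qed

text \<open>Once the count of nonzero columns is bounded by 0, a nonzero residual would contradict
  its strict decrease. For \<open>k\<close> beyond the dimension the factor in the second claim is
  \<open>1 - 1 / 0 = 1\<close>, and the claim says that the trace does not increase.\<close>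

lemma greedy_bounds:
  assumes "\<And>k \<omega>. \<omega> \<in> space M \<Longrightarrow>
    is_arg_max (\<lambda>v. v \<bullet> (R k \<omega> *v v)) (\<lambda>v. v \<in> range (\<lambda>i. axis i 1)) (u k \<omega>)"
  shows "CARD('n) \<le> k \<Longrightarrow> \<omega> \<in> space M \<Longrightarrow> R k \<omega> = 0"
    and "expectation (\<lambda>\<omega>. trace (R (Suc k) \<omega>))
      \<le> (1 - 1 / real (CARD('n) - k)) * expectation (\<lambda>\<omega>. trace (R k \<omega>))"
proof -
  have card: "card (nonzero_columns (R k \<omega>)) \<le> CARD('n) - k" if "\<omega> \<in> space M" for k \<omega>
    using greedy_card_nonzero_columns assms that by blast
  show "R k \<omega> = 0" if "CARD('n) \<le> k" "\<omega> \<in> space M"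
    using greedy_step(1)[OF pos_semidef assms, of \<omega> k] card[of \<omega> k] that by fastforce
  have "expectation (\<lambda>\<omega>. trace (R (Suc k) \<omega>))
      \<le> expectation (\<lambda>\<omega>. (1 - 1 / real (CARD('n) - k)) * trace (R k \<omega>))"
    using greedy_step(2)[OF pos_semidef assms card, of _ k]
    by (intro integral_mono integrable_mult_right integrable_trace) (simp add: R_Suc)
  then show "expectation (\<lambda>\<omega>. trace (R (Suc k) \<omega>))
      \<le> (1 - 1 / real (CARD('n) - k)) * expectation (\<lambda>\<omega>. trace (R k \<omega>))"
    by simp
qed

text \<open>\<open>N k\<close> plays the past of \<open>u k\<close>. As \<open>R k\<close> is
  measurable for it, averages over both variables can be taken first over a fresh direction with the
  residual fixed, which is where isotropy enters.\<close>

lemma random_rank_and_trace: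
  assumes iso: "isotropic_law \<nu>" and law: "\<And>k. distr M borel (u k) = \<nu>"
    and N: "\<And>k. space (N k) = space M" "\<And>k. R 0 \<in> borel_measurable (N k)"
      "\<And>k i. i < k \<Longrightarrow> u i \<in> borel_measurable (N k)"
    and indep: "\<And>k. indep_set (sets (vimage_algebra (space M) (u k) borel)) (sets (N k))"
  shows "AE \<omega> in M. dim (range ((*v) (R k \<omega>))) \<le> CARD('n) - k"
    and "k < CARD('n) \<Longrightarrow> expectation (\<lambda>\<omega>. trace (R (Suc k) \<omega>))
      \<le> (1 - 1 / real (CARD('n) - k)) * expectation (\<lambda>\<omega>. trace (R k \<omega>))"
proof -
  interpret L: isotropic_law \<nu> by fact
  have avg: "(\<integral>\<^sup>+\<omega>. h (R k \<omega>) (u k \<omega>) \<partial>M) = (\<integral>\<^sup>+\<omega>. \<integral>\<^sup>+x. h (R k \<omega>) x \<partial>\<nu> \<partial>M)"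
    if "case_prod h \<in> borel_measurable (borel \<Otimes>\<^sub>M borel)" for h k
  proof -
    have "R k \<in> borel_measurable (N k)" by (rule measurable_subalgebra[OF N])
    from nn_integral_indep[OF R_measurable u_measurable this N(1) indep that] show ?thesis
      unfolding law .
  qed
  show rank: "AE \<omega> in M. dim (range ((*v) (R k \<omega>))) \<le> CARD('n) - k" for k
  proof (induction k)
    case 0
    show ?case using dim_subset_UNIV[of "range ((*v) (R 0 _))"] by (intro AE_I2) (simp add: dim_subset_UNIV_cart)
  next
    case (Suc k)
    \<comment> \<open>The indicator of the event that a nonzero residual annihilates the direction,
      the only way for the rank bound to fail to improve.\<close>
    define h :: "real^'n^'n \<Rightarrow> real^'n \<Rightarrow> ennreal"
      where "h S x = (if S \<noteq> 0 \<and> S *v x = 0 then 1 else 0)" for S x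
    have h [measurable]: "case_prod h \<in> borel_measurable (borel \<Otimes>\<^sub>M borel)"
      unfolding h_def by measurable
    have "(\<integral>\<^sup>+x. h S x \<partial>\<nu>) = 0" for S
    proof (cases "S = 0")
      case False
      \<comment> \<open>If \<open>S *v x = 0\<close>, then \<open>x\<close> lies in the hyperplane
        orthogonal to this row, a null set.\<close>
      then obtain i where "row i S \<noteq> 0" by (auto simp: vec_eq_iff row_def)
      from L.AE_not_orthogonal[OF this] have "AE x in \<nu>. h S x = 0"
      proof eventually_elim
        case (elim x)
        have "(S *v x) $ i = row i S \<bullet> x"
          by (simp add: matrix_vector_mult_def row_def inner_vec_def)
        with elim have "S *v x \<noteq> 0" by auto
        then show ?case by (simp add: h_def)
      qed
      then have "(\<integral>\<^sup>+x. h S x \<partial>\<nu>) = (\<integral>\<^sup>+x. 0 \<partial>\<nu>)" by (rule nn_integral_cong_AE)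
      then show ?thesis by simp
    qed (simp add: h_def)
    then have "(\<integral>\<^sup>+\<omega>. h (R k \<omega>) (u k \<omega>) \<partial>M) = 0"
      by (simp add: avg[OF h])
    then have "AE \<omega> in M. h (R k \<omega>) (u k \<omega>) = 0"
      by (subst (asm) nn_integral_0_iff_AE) auto
    with Suc show ?case
      using AE_space
    proof eventually_elim
      case (elim \<omega>)
      show ?case
      proof (cases "R k \<omega> = 0")
        case True
        have "range ((*v) (0 :: real^'n^'n)) = {0}" by auto
        with True show ?thesis by (simp add: R_Suc[OF elim(3)] SR1_def)
      next
        case False
        with elim(2) have "R k \<omega> *v u k \<omega> \<noteq> 0" by (auto simp: h_def split: if_splits)
        from dim_range_SR1_0_less[OF pos_semidef[OF elim(3)] this] elim(1) show ?thesis
          by (simp add: R_Suc[OF elim(3)])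
      qed
    qed
  qed
  show "expectation (\<lambda>\<omega>. trace (R (Suc k) \<omega>))
      \<le> (1 - 1 / real (CARD('n) - k)) * expectation (\<lambda>\<omega>. trace (R k \<omega>))" if "k < CARD('n)" for k
  proof -
    let ?r = "CARD('n) - k"
    define h :: "real^'n^'n \<Rightarrow> real^'n \<Rightarrow> ennreal"
      where "h S x = ennreal (((S *v x) \<bullet> (S *v x)) / (x \<bullet> (S *v x)))" for S x
    have h [measurable]: "case_prod h \<in> borel_measurable (borel \<Otimes>\<^sub>M borel)"
      unfolding h_def by measurable
    have h_eq: "h (R k \<omega>) (u k \<omega>) = ennreal (trace (R k \<omega>) - trace (R (Suc k) \<omega>))" if "\<omega> \<in> space M" for \<omega>
      using pos_semidef[OF that, of k] by (simp add: h_def R_Suc[OF that] trace_SR1_0 pos_semidef_def)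
    have "ennreal (expectation (\<lambda>\<omega>. trace (R k \<omega>) / ?r)) = (\<integral>\<^sup>+\<omega>. ennreal (trace (R k \<omega>) / ?r) \<partial>M)"
      by (intro nn_integral_eq_integral[symmetric] integrable_divide integrable_trace AE_I2)
        (simp add: trace_nonneg)
    \<comment> \<open>The average drop is bounded for each fixed residual; the rank bound holds only
      almost everywhere.\<close>
    also have "\<dots> \<le> (\<integral>\<^sup>+\<omega>. \<integral>\<^sup>+x. h (R k \<omega>) x \<partial>\<nu> \<partial>M)"
      unfolding h_def
      by (rule nn_integral_mono_AE, use rank[of k] AE_space in eventually_elim)
        (intro expected_trace_decrease[OF iso] pos_semidef)
    also have "\<dots> = (\<integral>\<^sup>+\<omega>. h (R k \<omega>) (u k \<omega>) \<partial>M)" by (rule avg[OF h, symmetric])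
    also have "\<dots> = (\<integral>\<^sup>+\<omega>. ennreal (trace (R k \<omega>) - trace (R (Suc k) \<omega>)) \<partial>M)"
      by (intro nn_integral_cong h_eq)
    also have "\<dots> = ennreal (expectation (\<lambda>\<omega>. trace (R k \<omega>) - trace (R (Suc k) \<omega>)))"
      by (intro nn_integral_eq_integral Bochner_Integration.integrable_diff integrable_trace AE_I2)
        (simp add: trace_Suc_le)
    finally have "expectation (\<lambda>\<omega>. trace (R k \<omega>) / ?r) \<le> expectation (\<lambda>\<omega>. trace (R k \<omega>) - trace (R (Suc k) \<omega>))"
      by (subst (asm) ennreal_le_iff) (auto intro!: integral_nonneg_AE AE_I2 simp: trace_Suc_le)
    then show ?thesis
      by (simp add: integrable_trace algebra_simps)
  qed
qed

end

text \<open>The sigma-algebra is the one generated by the tuple of the past; its components are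
  recovered by projections.\<close>

lemma random_directions_subalgebra:
  fixes G0 :: "'w \<Rightarrow> real^'n^'n"
  assumes "random_directions M G0 u"
  shows "\<exists>N. space N = space M \<and> G0 \<in> borel_measurable N \<and> (\<forall>i<k. u i \<in> borel_measurable N) \<and>
    prob_space.indep_set M (sets (vimage_algebra (space M) (u k) borel)) (sets N)"
proof -
  define T where "T = (\<lambda>\<omega>. (G0 \<omega>, \<lambda>i\<in>{..<k}. u i \<omega>))"
  define P where "P = (borel \<Otimes>\<^sub>M PiM {..<k} (\<lambda>_. borel) :: ((real^'n^'n) \<times> (nat \<Rightarrow> real^'n)) measure)"
  define F where "F = vimage_algebra (space M) T P"
  have T: "T \<in> F \<rightarrow>\<^sub>M P"
    unfolding F_def by (rule measurable_vimage_algebra1)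
      (auto simp: T_def P_def space_pair_measure space_PiM)
  have F: "space F = space M" by (simp add: F_def)
  have "(\<lambda>\<omega>. fst (T \<omega>)) \<in> borel_measurable F"
    by (rule measurable_compose[OF T]) (simp add: P_def)
  then have "G0 \<in> borel_measurable F" by (simp add: T_def)
  moreover have "u i \<in> borel_measurable F" if "i < k" for i
  proof -
    have "(\<lambda>\<omega>. snd (T \<omega>) i) \<in> borel_measurable F"
      using that by (intro measurable_compose[OF T]) (simp add: P_def)
    then show ?thesis using that by (simp add: T_def)
  qed
  moreover have "prob_space.indep_set M (sets (vimage_algebra (space M) (u k) borel)) (sets F)"
    using assms by (simp add: random_directions_def F_def P_def T_def)
  ultimately show ?thesis using F by blast
qed

section \<open>Scalar sequences\<close>

lemma telescoping_bound:
  fixes y :: "nat \<Rightarrow> real"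
  assumes "0 \<le> y 0" "\<And>k. k < d \<Longrightarrow> y (Suc k) \<le> (1 - 1 / real (d - k)) * y k" "\<And>k. d \<le> k \<Longrightarrow> y k = 0"
  shows "y k \<le> max 0 (1 - real k / real d) * y 0"
proof -
  have "y k \<le> (1 - real k / real d) * y 0" if "k < d"
    using that
  proof (induction k)
    case (Suc k)
    have "y (Suc k) \<le> (1 - 1 / real (d - k)) * y k" using assms(2) Suc by simp
    also have "\<dots> \<le> (1 - 1 / real (d - k)) * ((1 - real k / real d) * y 0)"
      using Suc by (intro mult_left_mono) auto
    \<comment> \<open>The factors are \<open>(d - k - 1) / (d - k)\<close> and
      \<open>(d - k) / d\<close>, and \<open>d - k\<close> cancels.\<close>
    also have "\<dots> = (1 - real (Suc k) / real d) * y 0"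
      using Suc.prems by (simp add: of_nat_diff field_simps)
    finally show ?case .
  qed simp
  moreover have "(1 - real k / real d) * y 0 \<le> max 0 (1 - real k / real d) * y 0"
    using assms(1) by (intro mult_right_mono) auto
  ultimately show ?thesis
    using assms(1,3) by (cases "k < d") (auto intro: order_trans)
qed

text \<open>A comparison sequence may not have zeros, so the eventually vanishing sequence is
  dominated by a multiple of \<open>1 / fact k\<close>. Using \<open>c + 1\<close> instead of
  \<open>c\<close> keeps it nonzero when \<open>c = 0\<close>.\<close>

lemma superlinearly_converges_eventually_0:
  assumes bound: "\<And>k. 0 \<le> y k" "\<And>k. y k \<le> c" and zero: "\<And>k. d \<le> k \<Longrightarrow> y k = 0"
  shows "superlinearly_converges y 0"
proof -
  have c: "0 \<le> c" using bound[of 0] by simp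
  \<comment> \<open>At least \<open>c + 1\<close> while \<open>k \<le> d\<close>, with consecutive quotients \<open>1 / (k + 1)\<close>.\<close>
  define x where "x k = (c + 1) * fact d / fact k" for k :: nat
  have "(\<lambda>k. \<bar>x (Suc k)\<bar> / \<bar>x k\<bar>) = (\<lambda>k. inverse (real (Suc k)))"
  proof
    fix k
    have "x k > 0" "x (Suc k) = x k / real (Suc k)" using c by (simp_all add: x_def)
    then show "\<bar>x (Suc k)\<bar> / \<bar>x k\<bar> = inverse (real (Suc k))"
      by (simp add: divide_inverse)
  qed
  then have ratio: "(\<lambda>k. \<bar>x (Suc k)\<bar> / \<bar>x k\<bar>) \<longlonglongrightarrow> 0"
    using LIMSEQ_inverse_real_of_nat by simp
  \<comment> \<open>These are the terms of the exponential series at 1.\<close>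
  have "(\<lambda>k. 1 ^ k / fact k :: real) \<longlonglongrightarrow> 0"
    using summable_LIMSEQ_zero[OF summable_exp[of "1 :: real"]] by (simp add: divide_inverse)
  then have lim: "x \<longlonglongrightarrow> 0"
    using tendsto_mult_left[of "\<lambda>k. 1 / fact k" 0 sequentially "(c + 1) * fact d"]
    by (simp add: x_def[abs_def])
  have "\<bar>y k - 0\<bar> \<le> \<bar>x k\<bar>" for k
  proof (cases "k \<le> d")
    case True
    have "y k \<le> (c + 1) * 1" using bound(2)[of k] by simp
    also have "\<dots> \<le> (c + 1) * (fact d / fact k)"
      using c True by (intro mult_left_mono) (auto simp: fact_mono)
    finally show ?thesis using bound(1)[of k] c by (simp add: x_def)
  qed (simp add: zero)
  moreover have "x k \<noteq> 0" for k using c by (simp add: x_def)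
  ultimately show ?thesis
    using lim ratio unfolding superlinearly_converges_def by blast
qed

subsection \<open>Convergence of the SR1 methods\<close>

theorem theorem13:
  fixes M :: "'w measure"
    and A :: "real^'n^'n"
    and G :: "nat \<Rightarrow> 'w \<Rightarrow> real^'n^'n"
    and u :: "nat \<Rightarrow> 'w \<Rightarrow> real^'n"
  assumes "prob_space M"
    and "pos_def A"
    and "G 0 \<in> borel_measurable M"
    and "\<forall>\<omega>\<in>space M. transpose (G 0 \<omega>) = G 0 \<omega> \<and> A \<preceq>\<^sub>L G 0 \<omega>"
    and "\<forall>k. u k \<in> borel_measurable M"
    and "\<forall>k. \<forall>\<omega>\<in>space M. G (Suc k) \<omega> = SR1 (G k \<omega>) A (u k \<omega>)"
    and "greedy_directions M A G u \<or> random_directions M (G 0) u"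
    and "integrable M (\<lambda>\<omega>. trace (G 0 \<omega> - A))"
  shows "(\<forall>k. \<forall>\<omega>\<in>space M. A \<preceq>\<^sub>L G k \<omega>) \<and>
    (\<forall>k. integrable M (\<lambda>\<omega>. trace (G k \<omega> - A)) \<and>
       0 \<le> (\<integral>\<omega>. trace (G k \<omega> - A) \<partial>M) \<and>
       (\<integral>\<omega>. trace (G k \<omega> - A) \<partial>M)
         \<le> max 0 (1 - real k / real CARD('n)) * (\<integral>\<omega>. trace (G 0 \<omega> - A) \<partial>M)) \<and>
    superlinearly_converges (\<lambda>k. \<integral>\<omega>. trace (G k \<omega> - A) \<partial>M) 0 \<and>
    (greedy_directions M A G u \<longrightarrow> (\<forall>k\<ge>CARD('n). \<forall>\<omega>\<in>space M. G k \<omega> = A)) \<and>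
    (random_directions M (G 0) u \<longrightarrow> (\<forall>k\<ge>CARD('n). AE \<omega> in M. G k \<omega> = A))"
proof -
  interpret prob_space M by fact
  define R where "R k \<omega> = G k \<omega> - A" for k \<omega>
  have G_R: "G k \<omega> = A \<longleftrightarrow> R k \<omega> = 0" for k \<omega> by (simp add: R_def)
  have R_0: "R 0 \<in> borel_measurable M"
    using assms(3) by (simp add: R_def[abs_def])
  interpret residual_process M R u
  proof
    show "R (Suc k) \<omega> = SR1 (R k \<omega>) 0 (u k \<omega>)" if "\<omega> \<in> space M" for k \<omega>
      using assms(6) that by (simp add: R_def SR1_diff)
  qed (use assms R_0 in \<open>auto simp: R_def loewner_le_def\<close>)
  define y where "y k = expectation (\<lambda>\<omega>. trace (R k \<omega>))" for k
  have greedy: "(\<forall>k\<ge>CARD('n). \<forall>\<omega>\<in>space M. R k \<omega> = 0) \<and>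
      (\<forall>k. y (Suc k) \<le> (1 - 1 / real (CARD('n) - k)) * y k)"
    if "greedy_directions M A G u"
    unfolding y_def using greedy_bounds that by (auto simp: greedy_directions_def R_def)
  have random: "(\<forall>k\<ge>CARD('n). AE \<omega> in M. R k \<omega> = 0) \<and>
      (\<forall>k<CARD('n). y (Suc k) \<le> (1 - 1 / real (CARD('n) - k)) * y k)"
    if random: "random_directions M (G 0) u"
  proof -
    obtain \<nu> where law: "distr M borel (u k) = \<nu>" and \<nu>: "\<nu> = std_normal_vec \<or> \<nu> = unif_sphere" for k
      using random unfolding random_directions_def by metis
    \<comment> \<open>As the law of \<open>u 0\<close>, \<open>\<nu>\<close> has mass 1, which the
      normal case of isotropy requires.\<close>
    have "prob_space \<nu>"
      using prob_space_distr[OF u_measurable[of 0]] by (simp add: law)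
    then have iso: "isotropic_law \<nu>"
      using \<nu> isotropic_law_std_normal_vec isotropic_law_unif_sphere by auto
    obtain N where N: "space (N k) = space M" "G 0 \<in> borel_measurable (N k)"
        "i < k \<Longrightarrow> u i \<in> borel_measurable (N k)"
        "indep_set (sets (vimage_algebra (space M) (u k) borel)) (sets (N k))" for k i
      using random_directions_subalgebra[OF random] by metis
    have R0: "R 0 \<in> borel_measurable (N k)" for k
      using N(2)[of k] by (simp add: R_def[abs_def])
    have "AE \<omega> in M. R k \<omega> = 0" if "CARD('n) \<le> k" for k
    proof -
      have "AE \<omega> in M. dim (range ((*v) (R k \<omega>))) \<le> CARD('n) - k"
        by (rule random_rank_and_trace(1)[OF iso law N(1) R0]) (use N(3,4) in auto)
      then show ?thesis by eventually_elim (use that in \<open>auto intro: range_mult_vector_dim_0\<close>)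
    qed
    moreover have "y (Suc k) \<le> (1 - 1 / real (CARD('n) - k)) * y k" if "k < CARD('n)" for k
      unfolding y_def
      by (rule random_rank_and_trace(2)[OF iso law N(1) R0]) (use N(3,4) that in auto)
    ultimately show ?thesis by blast
  qed
  have step: "y (Suc k) \<le> (1 - 1 / real (CARD('n) - k)) * y k" if "k < CARD('n)" for k
    using assms(7) greedy random that by blast
  \<comment> \<open>Almost sure vanishing is enough for the expectation, so both methods are treated
    together.\<close>
  have zero: "y k = 0" if "CARD('n) \<le> k" for k
  proof -
    have "AE \<omega> in M. R k \<omega> = 0" using assms(7) greedy random that by (auto intro: AE_I2)
    moreover have "trace (0 :: real^'n^'n) = 0" by (simp add: trace_def)
    ultimately have "y k = expectation (\<lambda>\<omega>. 0)"
      unfolding y_def by (intro integral_cong_AE) auto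
    then show ?thesis by simp
  qed
  have nonneg: "0 \<le> y k" for k by (simp add: y_def expectation_trace_nonneg)
  have bound: "y k \<le> max 0 (1 - real k / real CARD('n)) * y 0" for k
    using nonneg step zero by (rule telescoping_bound)
  have "y k \<le> y 0" for k
    using bound[of k] mult_right_mono[OF _ nonneg[of 0], of "max 0 (1 - real k / real CARD('n))" 1] by simp
  with nonneg zero have "superlinearly_converges y 0"
    by (intro superlinearly_converges_eventually_0)
  then show ?thesis
    unfolding G_R loewner_le_def R_def[symmetric] y_def[symmetric]
    using pos_semidef integrable_trace nonneg bound greedy random
    by (auto simp: y_def[abs_def])
qed

end
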